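(* Let $\mu>0$ and $\delta\in(0,1)$. Let $A$ be the random field $A(\omega,x)=A_0(x)+\sum_{j=1}^\infty Y_j(\omega)\Psi_j(x)$, with $A_0$, $Y_j$, $\Psi_j$ as described in the context. If $A_0\in\mathrm{NT}_A(\mu)$ and $$\sum_{j=1}^\infty\operatorname*{ess\,sup}_{x\in D_R}\big\|\Psi_j(x)-(x\cdot\nabla)\Psi_j(x)\big\|_2\le2\delta\mu,$$ then $A(\omega)\in\mathrm{NT}_A((1-\delta)\mu)$ almost surely.
   Context: Geometry. $d\in\{2,3\}$. Either $D_-\subset\mathbb{R}^d$ is a bounded Lipschitz open set with $0\in D_-$ and $D_+:=\mathbb{R}^d\setminus\overline{D_-}$ connected, or $D_-=\emptyset$ (and $D_+=\mathbb{R}^d$). $B_R$ is the ball of radius $R>0$ centred at the origin, $D_R=D_+\cap B_R$. $E\subset\subset B_R$ means $E$ is a compact subset of the open ball $B_R$. $\mathsf{SPD}$ is the set of symmetric positive-definite matrices in $\mathbb{R}^{d\times d}$; $\|\cdot\|_2$ is the spectral norm. The class $\mathrm{NT}_A$. For $\mu>0$ and a function $B\in W^{1,\infty}(D_R;\mathsf{SPD})$ with $\operatorname{ess\,supp}(I-B)\subset\subset B_R$, write $B\in\mathrm{NT}_A(\mu)$ if $B(x)-(x\cdot\nabla)B(x)\ge\mu$ for almost every $x\in D_R$, in the sense of quadratic forms. Random field. $(\Omega,\mathcal{F},\mathbb{P})$ is a complete probability space. $A_0\in W^{1,\infty}(D_R;\mathsf{SPD})$ is deterministic with $\operatorname{ess\,supp}(I-A_0)\subset\subset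 B_R$, and $A_{0,\min}>0$ is such that $A_{0,\min}|\xi|^2\le(A_0(x)\xi)\cdot\overline{\xi}$ for a.e. $x$ and all $\xi\in\mathbb{C}^d$. The $Y_j$ are i.i.d. random variables uniformly distributed on $(-1/2,1/2)$. The $\Psi_j\in W^{1,\infty}(D_R;\mathbb{R}^{d\times d})$ are symmetric-matrix-valued with $\operatorname{ess\,supp}\Psi_j\subset\subset B_R$ for all $j\ge1$, and $$\sum_{j=1}^\infty\|\Psi_j\|_{W^{1,\infty}(D_R;\mathbb{R}^{d\times d})}<\infty,\qquad\sum_{j=1}^\infty\operatorname*{ess\,sup}_{x\in D_R}\|\Psi_j(x)\|_2<2A_{0,\min}.$$ As for every random coefficient $A$ considered, it is assumed that $\operatorname{ess\,supp}(I-A(\omega))\subset\subset B_R$ almost surely. *)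

theory Defs
  imports "HOL-Probability.Probability"
begin

text \<open>Near each boundary point the set is, after a rigid motion, the part of space strictly
  below the graph of a Lipschitz function. The rigid motion is encoded by the unit
  vector \<open>e\<close> (the ``vertical'' direction), and \<open>y - (y \<bullet> e) *\<^sub>R e\<close> is the ``horizontal'' part
  of \<open>y\<close>, on which the function \<open>g\<close> is evaluated.\<close>

definition lipschitz_open_set :: "'a::euclidean_space set \<Rightarrow> bool" where
  "lipschitz_open_set D \<longleftrightarrow> open D \<and>
     (\<forall>x\<in>frontier D. \<exists>W e g L. open W \<and> x \<in> W \<and> norm e = 1 \<and>
        L-lipschitz_on {z. z \<bullet> e = 0} g \<and>
        D \<inter> W = {y \<in> W. y \<bullet> e < g (y - (y \<bullet> e) *\<^sub>R e)})"

definition D_plus :: "(real^'d) set \<Rightarrow> (real^'d) set" where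
  "D_plus Dm = UNIV - closure Dm"

definition obstacle :: "(real^'d) set \<Rightarrow> bool" where
  "obstacle Dm \<longleftrightarrow> Dm = {} \<or>
     (bounded Dm \<and> lipschitz_open_set Dm \<and> 0 \<in> Dm \<and> connected (D_plus Dm))"

definition D_R :: "(real^'d) set \<Rightarrow> real \<Rightarrow> (real^'d) set" where
  "D_R Dm R = D_plus Dm \<inter> ball 0 R"

definition compactly_in :: "'a::topological_space set \<Rightarrow> 'a set \<Rightarrow> bool" where
  "compactly_in E S \<longleftrightarrow> compact E \<and> E \<subseteq> S"

text \<open>The support is taken in the whole space: it is the complement of the largest open
  subset \<open>V\<close> of the whole space such that \<open>f = 0\<close> almost everywhere on \<open>V \<inter> U\<close>. It is thus
  closed, and it may meet the boundary of \<open>U\<close>.\<close>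

definition ess_supp :: "'a::euclidean_space set \<Rightarrow> ('a \<Rightarrow> 'b::real_normed_vector) \<Rightarrow> 'a set" where
  "ess_supp U f = - \<Union>{V. open V \<and> (AE x in lebesgue_on U. x \<in> V \<longrightarrow> f x = 0)}"

definition partial_deriv :: "'d \<Rightarrow> (real^'d \<Rightarrow> real) \<Rightarrow> real^'d \<Rightarrow> real" where
  "partial_deriv i \<phi> x = frechet_derivative \<phi> (at x) (axis i 1)"

primrec Ck :: "nat \<Rightarrow> (real^'d \<Rightarrow> real) \<Rightarrow> bool" where
  "Ck 0 \<phi> \<longleftrightarrow> continuous_on UNIV \<phi>"
| "Ck (Suc k) \<phi> \<longleftrightarrow> (\<forall>x. \<phi> differentiable at x) \<and> (\<forall>i. Ck k (partial_deriv i \<phi>))"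

definition test_functions :: "(real^'d) set \<Rightarrow> (real^'d \<Rightarrow> real) set" where
  "test_functions U = {\<phi>. (\<forall>k. Ck k \<phi>) \<and> compactly_in (closure {x. \<phi> x \<noteq> 0}) U}"

definition locally_integrable ::
    "'a::euclidean_space set \<Rightarrow> ('a \<Rightarrow> 'b::euclidean_space) \<Rightarrow> bool" where
  "locally_integrable U f \<longleftrightarrow> (\<forall>K. compactly_in K U \<longrightarrow> set_integrable lebesgue K f)"

definition has_weak_deriv ::
    "(real^'d) set \<Rightarrow> 'd \<Rightarrow> (real^'d \<Rightarrow> 'b::euclidean_space) \<Rightarrow> (real^'d \<Rightarrow> 'b) \<Rightarrow> bool" where
  "has_weak_deriv U i f g \<longleftrightarrow> locally_integrable U f \<and> locally_integrable U g \<and>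
     (\<forall>\<phi>\<in>test_functions U.
        (LINT x:U|lebesgue. partial_deriv i \<phi> x *\<^sub>R f x) =
        - (LINT x:U|lebesgue. \<phi> x *\<^sub>R g x))"

text \<open>On an open set \<open>U\<close>, a weak derivative is determined up to a null set of \<open>U\<close>; an arbitrary
  representative is chosen, and it is only used in statements that ignore null sets.\<close>

definition weak_deriv ::
    "(real^'d) set \<Rightarrow> 'd \<Rightarrow> (real^'d \<Rightarrow> 'b::euclidean_space) \<Rightarrow> real^'d \<Rightarrow> 'b" where
  "weak_deriv U i f = (SOME g. has_weak_deriv U i f g)"

text \<open>The values of the norms below lie in \<open>[0,\<infinity>]\<close>. In particular, the essential
  supremum of a non-measurable function is \<open>\<infinity>\<close>, and over a null set it is \<open>0\<close>. On matrices,
  \<^term>\<open>norm\<close> is the Frobenius norm, which is equivalent to the spectral norm.\<close>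

definition Linf_norm ::
    "(real^'d) set \<Rightarrow> (real^'d \<Rightarrow> 'b::euclidean_space) \<Rightarrow> ennreal" where
  "Linf_norm U f = esssup (lebesgue_on U) (\<lambda>x. ennreal (norm (f x)))"

definition Linf :: "(real^'d) set \<Rightarrow> (real^'d \<Rightarrow> 'b::euclidean_space) set" where
  "Linf U = {f. f \<in> borel_measurable (lebesgue_on U) \<and> Linf_norm U f < \<infinity>}"

definition W1inf :: "(real^'d) set \<Rightarrow> (real^'d \<Rightarrow> 'b::euclidean_space) set" where
  "W1inf U = {f. f \<in> Linf U \<and> (\<forall>i. \<exists>g\<in>Linf U. has_weak_deriv U i f g)}"

definition W1inf_norm ::
    "(real^'d) set \<Rightarrow> (real^'d \<Rightarrow> 'b::euclidean_space) \<Rightarrow> ennreal" where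
  "W1inf_norm U f = Linf_norm U f + (\<Sum>i\<in>UNIV. Linf_norm U (weak_deriv U i f))"

text \<open>The operator \<open>x \<cdot> \<nabla>\<close>, acting entrywise on matrix-valued functions.\<close>

definition radial_deriv ::
    "(real^'d) set \<Rightarrow> (real^'d \<Rightarrow> 'b::euclidean_space) \<Rightarrow> real^'d \<Rightarrow> 'b" where
  "radial_deriv U f x = (\<Sum>i\<in>UNIV. (x $ i) *\<^sub>R weak_deriv U i f x)"

definition symmetric_matrix :: "real^'d^'d \<Rightarrow> bool" where
  "symmetric_matrix M \<longleftrightarrow> transpose M = M"

definition SPD :: "(real^'d^'d) set" where
  "SPD = {M. symmetric_matrix M \<and> (\<forall>\<xi>. \<xi> \<noteq> 0 \<longrightarrow> 0 < (M *v \<xi>) \<bullet> \<xi>)}"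

definition spectral_norm :: "real^'d^'d \<Rightarrow> real" where
  "spectral_norm M = onorm (\<lambda>\<xi>. M *v \<xi>)"

text \<open>The lower bound \<open>c |\<xi>|\<^sup>2 \<le> (M \<xi>) \<cdot> cnj \<xi>\<close> for all complex vectors. The matrix is
  real; if it is symmetric, the right-hand side is real, so that taking the real part
  changes nothing.\<close>

definition form_ge :: "real^'d^'d \<Rightarrow> real \<Rightarrow> bool" where
  "form_ge M c \<longleftrightarrow>
     (\<forall>\<xi>::complex^'d. c * (norm \<xi>)\<^sup>2 \<le>
        Re (\<Sum>i\<in>UNIV. (map_matrix complex_of_real M *v \<xi>) $ i * cnj (\<xi> $ i)))"

definition W1inf_SPD :: "(real^'d) set \<Rightarrow> (real^'d \<Rightarrow> real^'d^'d) set" where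
  "W1inf_SPD U = {B. B \<in> W1inf U \<and> (AE x in lebesgue_on U. B x \<in> SPD)}"

definition NT_A :: "(real^'d) set \<Rightarrow> real \<Rightarrow> real \<Rightarrow> (real^'d \<Rightarrow> real^'d^'d) set" where
  "NT_A Dm R \<mu> = {B. B \<in> W1inf_SPD (D_R Dm R) \<and>
     compactly_in (ess_supp (D_R Dm R) (\<lambda>x. mat 1 - B x)) (ball 0 R) \<and>
     (AE x in lebesgue_on (D_R Dm R). form_ge (B x - radial_deriv (D_R Dm R) B x) \<mu>)}"

text \<open>If the \<open>\<Psi> j\<close> have summable essential suprema, the series converges absolutely for
  almost every \<open>x\<close> whenever the \<open>Y j \<omega>\<close> are bounded; at the remaining points its value is
  irrelevant.\<close>

definition random_field ::
    "(real^'d \<Rightarrow> real^'d^'d) \<Rightarrow> (nat \<Rightarrow> 'w \<Rightarrow> real) \<Rightarrow> (nat \<Rightarrow> real^'d \<Rightarrow> real^'d^'d)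
      \<Rightarrow> 'w \<Rightarrow> real^'d \<Rightarrow> real^'d^'d" where
  "random_field A0 Y \<Psi> \<omega> x = A0 x + (\<Sum>j. Y j \<omega> *\<^sub>R \<Psi> j x)"

end

theory Submission
  imports Defs "HOL-Computational_Algebra.Polynomial"
begin

text \<open>
  Almost surely all coefficients satisfy \<open>\<bar>Y j \<omega>\<bar> \<le> 1 / 2\<close>, and for such an outcome \<open>\<omega>\<close> the claim is
  deterministic. If the series may be differentiated term by term, then
  \<open>A - (x \<cdot> \<nabla>) A = (A0 - (x \<cdot> \<nabla>) A0) + (\<Sum>j. Y j (\<Psi> j - (x \<cdot> \<nabla>) \<Psi> j))\<close> almost everywhere. The first
  part is at least \<open>\<mu>\<close> as a quadratic form, and the second is at least minus half the sum of the
  essential suprema of the spectral norms, hence at least \<open>- \<delta> \<mu>\<close>. The same estimate for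
  \<open>A = A0 + (\<Sum>j. Y j \<Psi> j)\<close> shows that \<open>A\<close> is positive definite almost everywhere
  (\<open>form_ge_add_suminf\<close>).

  Termwise differentiation has two ingredients. The series of the weak derivatives is a weak derivative
  of the series, by dominated convergence (\<open>has_weak_deriv_suminf\<close>). As the class \<open>NT\<^sub>A\<close> refers to an
  arbitrarily chosen weak derivative of \<open>A\<close>, weak derivatives must also be unique almost everywhere
  (\<open>has_weak_deriv_unique\<close>). This is the fundamental lemma of the calculus of variations; it is
  obtained by approximating indicators of boxes by smooth bumps built from \<open>exp (- (1 / t))\<close>,
  followed by Lebesgue differentiation.
\<close>

section \<open>Smooth bump functions\<close>

text \<open>The function \<open>exp (- (1 / t))\<close>, extended by \<open>0\<close> to \<open>t \<le> 0\<close>, has the \<open>n\<close>-th derivative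
  \<open>p\<^sub>n (1 / t) * exp (- (1 / t))\<close> for \<open>t > 0\<close>; the chain rule gives the recursion
  \<open>p\<^sub>n\<^sub>+\<^sub>1 = X\<^sup>2 (p\<^sub>n - p\<^sub>n')\<close> for the polynomials \<open>p\<^sub>n\<close>, here \<open>flat_poly n\<close>.\<close>

primrec flat_poly :: "nat \<Rightarrow> real poly" where
  "flat_poly 0 = 1"
| "flat_poly (Suc n) = [:0, 0, 1:] * (flat_poly n - pderiv (flat_poly n))"

text \<open>The \<open>n\<close>-th derivative of the flat function \<open>exp (- (1 / t))\<close>. Having the whole sequence of
  derivatives as one family makes the smoothness proof a single differentiation step.\<close>

definition flat_exp :: "nat \<Rightarrow> real \<Rightarrow> real" where
  "flat_exp n t = (if t \<le> 0 then 0 else poly (flat_poly n) (1 / t) * exp (- (1 / t)))"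

lemma poly_times_exp_minus_tendsto_0:
  "((\<lambda>s. poly p s * exp (- s)) \<longlongrightarrow> (0::real)) at_top"
proof -
  have "((\<lambda>s. \<Sum>i\<le>degree p. coeff p i * (s ^ i / exp s)) \<longlongrightarrow> (0::real)) at_top"
    by (intro tendsto_null_sum tendsto_mult_right_zero tendsto_power_div_exp_0)
  then show ?thesis
    by (simp add: poly_altdef exp_minus sum_distrib_right divide_inverse mult.assoc)
qed

lemma has_real_derivative_flat_exp: "(flat_exp n has_real_derivative flat_exp (Suc n) t) (at t)"
proof -
  consider "t < 0" | "t = 0" | "t > 0" by linarith
  then show ?thesis
  proof cases
    case 1
    have "((\<lambda>_. 0) has_real_derivative 0) (at t)" by simp
    moreover have "\<forall>\<^sub>F s in nhds t. flat_exp n s = 0"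
      using eventually_nhds_in_open[of "{..<0}" t] 1 by (auto elim!: eventually_mono simp: flat_exp_def)
    ultimately show ?thesis
      using 1 DERIV_cong_ev[of t t "flat_exp n" "\<lambda>_. 0" 0 0] by (simp add: flat_exp_def)
  next
    case 3
    let ?g = "\<lambda>t. poly (flat_poly n) (1 / t) * exp (- (1 / t))"
    have *: "(?g has_real_derivative flat_exp (Suc n) t) (at t)"
      using 3 by (auto intro!: derivative_eq_intros poly_DERIV[THEN DERIV_chain2]
          simp: flat_exp_def field_simps power2_eq_square)
    moreover have "\<forall>\<^sub>F s in nhds t. flat_exp n s = ?g s"
      using eventually_nhds_in_open[of "{0<..}" t] 3 by (auto elim!: eventually_mono simp: flat_exp_def)
    ultimately show ?thesis
      using DERIV_cong_ev[of t t "flat_exp n" ?g] by blast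
  next
    case 2
    \<comment> \<open>for \<open>h > 0\<close> the difference quotient is \<open>q (1 / h) * exp (- (1 / h))\<close> with \<open>q = X p\<^sub>n\<close>\<close>
    have "((\<lambda>h. flat_exp n h / h) \<longlongrightarrow> 0) (at_right 0)"
    proof -
      have "((\<lambda>h. poly ([:0, 1:] * flat_poly n) (inverse h) * exp (- inverse h)) \<longlongrightarrow> 0) (at_right (0::real))"
        by (rule filterlim_compose[OF poly_times_exp_minus_tendsto_0 filterlim_inverse_at_top_right])
      moreover have "\<forall>\<^sub>F h in at_right (0::real).
          poly ([:0, 1:] * flat_poly n) (inverse h) * exp (- inverse h) = flat_exp n h / h"
        by (auto simp: eventually_at_filter flat_exp_def field_simps intro!: always_eventually)
      ultimately show ?thesis using tendsto_cong by fast
    qed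
    moreover have "((\<lambda>h. flat_exp n h / h) \<longlongrightarrow> 0) (at_left 0)"
    proof (rule tendsto_eventually)
      show "\<forall>\<^sub>F h in at_left 0. flat_exp n h / h = 0"
        by (auto simp: eventually_at_filter flat_exp_def intro!: always_eventually)
    qed
    ultimately have "((\<lambda>h. flat_exp n h / h) \<longlongrightarrow> 0) (at 0)"
      by (simp add: filterlim_split_at)
    then show ?thesis using 2 by (simp add: DERIV_def flat_exp_def)
  qed
qed

lemma flat_exp_0: "flat_exp 0 t = (if t \<le> 0 then 0 else exp (- (1 / t)))"
  by (simp add: flat_exp_def)

lemma partial_deriv_eq:
  "(\<phi> has_derivative \<phi>') (at x) \<Longrightarrow> partial_deriv i \<phi> x = \<phi>' (axis i 1)"
  unfolding partial_deriv_def using frechet_derivative_at by metis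

lemma Ck_Suc_imp: "Ck (Suc k) \<phi> \<Longrightarrow> Ck k \<phi>"
proof (induction k arbitrary: \<phi>)
  case 0
  then show ?case
    by (auto intro!: continuous_at_imp_continuous_on differentiable_imp_continuous_within)
next
  case (Suc k)
  then show ?case by (metis Ck.simps(2))
qed

lemma Ck_const: "Ck k (\<lambda>_. c)"
proof (induction k arbitrary: c)
  case (Suc k)
  have "partial_deriv i (\<lambda>_. c) = (\<lambda>_. 0)" for i :: 'a
    by (rule ext) (simp add: partial_deriv_eq[OF has_derivative_const])
  then show ?case using Suc[of 0] by simp
qed auto

lemma Ck_add: "Ck k \<phi> \<Longrightarrow> Ck k \<psi> \<Longrightarrow> Ck k (\<lambda>x. \<phi> x + \<psi> x)"
proof (induction k arbitrary: \<phi> \<psi>)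
  case (Suc k)
  then have d: "\<phi> differentiable at x" "\<psi> differentiable at x" for x by auto
  have "partial_deriv i (\<lambda>x. \<phi> x + \<psi> x) = (\<lambda>x. partial_deriv i \<phi> x + partial_deriv i \<psi> x)" for i
  proof
    fix x
    show "partial_deriv i (\<lambda>x. \<phi> x + \<psi> x) x = partial_deriv i \<phi> x + partial_deriv i \<psi> x"
      using partial_deriv_eq[OF has_derivative_add[OF d[THEN frechet_derivative_works[THEN iffD1]]]]
      by (simp add: partial_deriv_def)
  qed
  then show ?case using Suc d by auto
qed (auto intro: continuous_intros)

lemma Ck_mult: "Ck k \<phi> \<Longrightarrow> Ck k \<psi> \<Longrightarrow> Ck k (\<lambda>x. \<phi> x * \<psi> x)"
proof (induction k arbitrary: \<phi> \<psi>)
  case (Suc k)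
  then have d: "\<phi> differentiable at x" "\<psi> differentiable at x" for x by auto
  have "partial_deriv i (\<lambda>x. \<phi> x * \<psi> x) =
      (\<lambda>x. \<phi> x * partial_deriv i \<psi> x + partial_deriv i \<phi> x * \<psi> x)" for i
  proof
    fix x
    show "partial_deriv i (\<lambda>x. \<phi> x * \<psi> x) x =
        \<phi> x * partial_deriv i \<psi> x + partial_deriv i \<phi> x * \<psi> x"
      using partial_deriv_eq[OF has_derivative_mult[OF d[THEN frechet_derivative_works[THEN iffD1]]]]
      by (simp add: partial_deriv_def)
  qed
  moreover have "Ck k \<phi>" "Ck k \<psi>" using Suc.prems Ck_Suc_imp by blast+
  ultimately show ?case using Suc d by (auto intro!: Ck_add)
qed (auto intro: continuous_intros)

lemma Ck_prod: "finite I \<Longrightarrow> (\<And>i. i \<in> I \<Longrightarrow> Ck k (\<phi> i)) \<Longrightarrow> Ck k (\<lambda>x. \<Prod>i\<in>I. \<phi> i x)"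
  by (induction I rule: finite_induct) (auto intro!: Ck_mult Ck_const)

lemma Ck_flat_exp: "Ck k (\<lambda>x::real^'d. flat_exp n (c * (x $ j) + d))"
proof (induction k arbitrary: n)
  case 0
  have "continuous_on UNIV (flat_exp n)"
    using has_real_derivative_flat_exp DERIV_continuous_on by blast
  then show ?case by (auto intro!: continuous_on_compose2[of UNIV "flat_exp n"] continuous_intros)
next
  case (Suc k)
  \<comment> \<open>the statement is about every member of the family, because differentiation shifts \<open>n\<close>\<close>
  have d: "((\<lambda>x::real^'d. flat_exp n (c * (x $ j) + d)) has_derivative
      (\<lambda>v. flat_exp (Suc n) (c * (x $ j) + d) * (c * (v $ j)))) (at x)" for x
    by (rule has_derivative_eq_rhs,
        rule DERIV_compose_FDERIV[OF has_real_derivative_flat_exp, where g = "\<lambda>x::real^'d. c * (x $ j) + d"])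
      (auto intro!: derivative_eq_intros bounded_linear_imp_has_derivative bounded_linear_vec_nth)
  have "partial_deriv i (\<lambda>x::real^'d. flat_exp n (c * (x $ j) + d)) =
      (\<lambda>x. (c * axis i 1 $ j) * flat_exp (Suc n) (c * (x $ j) + d))" for i
    using partial_deriv_eq[OF d] by auto
  then show ?case
    using d Suc by (auto simp: differentiable_def intro!: Ck_mult Ck_const)
qed

text \<open>Smooth functions that vanish off the open box \<open>box a b\<close>, take values in \<open>[0, 1]\<close>, and tend
  pointwise to the indicator of that box, since \<open>exp (- (1 / (n s)))\<close> tends to \<open>1\<close> as \<open>n\<close> grows
  if \<open>s > 0\<close>.\<close>

definition box_bump :: "real^'d \<Rightarrow> real^'d \<Rightarrow> nat \<Rightarrow> real^'d \<Rightarrow> real" where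
  "box_bump a b n x = (\<Prod>i\<in>UNIV. flat_exp 0 (real n * (x $ i - a $ i)) * flat_exp 0 (real n * (b $ i - x $ i)))"

lemma Ck_box_bump: "Ck k (box_bump a b n)"
proof -
  have "Ck k (\<lambda>x. \<Prod>i\<in>UNIV. flat_exp 0 (real n * (x $ i) + (- (real n * a $ i))) *
      flat_exp 0 ((- real n) * (x $ i) + real n * b $ i))"
    by (intro Ck_prod Ck_mult Ck_flat_exp) auto
  then show ?thesis by (simp add: box_bump_def[abs_def] algebra_simps)
qed

lemma box_bump_outside:
  assumes "x \<notin> box a b" shows "box_bump a b n x = 0"
proof -
  from assms obtain i where "x $ i \<le> a $ i \<or> b $ i \<le> x $ i"
    by (auto simp: mem_box_cart not_less)
  then have "flat_exp 0 (real n * (x $ i - a $ i)) * flat_exp 0 (real n * (b $ i - x $ i)) = 0"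
    by (auto simp: flat_exp_0 mult_nonneg_nonpos)
  then show ?thesis unfolding box_bump_def by (auto intro!: prod_zero)
qed

lemma box_bump_bound: "\<bar>box_bump a b n x\<bar> \<le> 1"
proof -
  have "0 \<le> flat_exp 0 t \<and> flat_exp 0 t \<le> 1" for t by (auto simp: flat_exp_0)
  then show ?thesis
    unfolding box_bump_def abs_prod by (intro prod_le_1) (auto simp: abs_mult intro!: mult_le_one)
qed

lemma box_bump_tendsto: "(\<lambda>n. box_bump a b n x) \<longlonglongrightarrow> indicator (box a b) x"
proof (cases "x \<in> box a b")
  case True
  have *: "(\<lambda>n. flat_exp 0 (real n * s)) \<longlonglongrightarrow> 1" if "s > 0" for s
  proof -
    have "(\<lambda>n. exp (- (1 / (real n * s)))) \<longlonglongrightarrow> exp (- 0)"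
      using that by (intro tendsto_intros) real_asymp
    moreover have "\<forall>\<^sub>F n in sequentially. exp (- (1 / (real n * s))) = flat_exp 0 (real n * s)"
      using that by (auto simp: flat_exp_0 eventually_sequentially mult_le_0_iff not_less)
    ultimately show ?thesis using tendsto_cong by force
  qed
  have "(\<lambda>n. box_bump a b n x) \<longlonglongrightarrow> (\<Prod>i\<in>(UNIV::'a set). 1 * 1)"
    unfolding box_bump_def
    by (intro tendsto_intros *) (use True in \<open>auto simp: mem_box_cart\<close>)
  then show ?thesis using True by simp
qed (simp add: box_bump_outside)

lemma box_bump_test_function:
  assumes "cbox a b \<subseteq> U" shows "box_bump a b n \<in> test_functions U"
proof -
  have "closure {x. box_bump a b n x \<noteq> 0} \<subseteq> cbox a b"
    using box_bump_outside box_subset_cbox by (intro closure_minimal closed_cbox) fast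
  moreover from this have "compact (closure {x. box_bump a b n x \<noteq> 0})"
    using bounded_subset[OF bounded_cbox] compact_eq_bounded_closed by blast
  ultimately show ?thesis
    using assms by (auto simp: test_functions_def compactly_in_def Ck_box_bump)
qed

section \<open>Uniqueness of weak derivatives\<close>

lemma test_functions_partial_deriv:
  assumes "\<phi> \<in> test_functions U" shows "partial_deriv i \<phi> \<in> test_functions U"
proof -
  let ?K = "closure {x. \<phi> x \<noteq> 0}"
  have "partial_deriv i \<phi> x = 0" if "x \<notin> ?K" for x
  proof -
    have "(\<phi> has_derivative (\<lambda>_. 0)) (at x)"
      using that closure_subset[of "{x. \<phi> x \<noteq> 0}"]
      by (intro has_derivative_transform_within_open[OF has_derivative_const[of 0], of "- ?K"])
         (auto simp: open_Compl)
    then show ?thesis by (simp add: partial_deriv_eq)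
  qed
  then have *: "closure {x. partial_deriv i \<phi> x \<noteq> 0} \<subseteq> ?K"
    by (intro closure_minimal) auto
  have "compact ?K" "?K \<subseteq> U" using assms by (auto simp: test_functions_def compactly_in_def)
  then have "compactly_in (closure {x. partial_deriv i \<phi> x \<noteq> 0}) U"
    using * unfolding compactly_in_def
    by (auto simp: compact_eq_bounded_closed intro: bounded_subset)
  moreover have "Ck k (partial_deriv i \<phi>)" for k
  proof -
    have "Ck (Suc k) \<phi>" using assms unfolding test_functions_def by blast
    then show ?thesis by simp
  qed
  ultimately show ?thesis by (simp add: test_functions_def)
qed

lemma test_function_continuous: "\<phi> \<in> test_functions U \<Longrightarrow> continuous_on UNIV \<phi>"
  unfolding test_functions_def using Ck.simps(1) by blast

lemma test_function_bounded:
  assumes "\<phi> \<in> test_functions U" obtains C where "\<And>x. \<bar>\<phi> x\<bar> \<le> C"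
proof -
  let ?K = "closure {x. \<phi> x \<noteq> 0}"
  have "compact ?K" using assms by (simp add: test_functions_def compactly_in_def)
  then have "compact (\<phi> ` ?K)"
    using test_function_continuous[OF assms] by (meson compact_continuous_image continuous_on_subset subset_UNIV)
  then obtain C where C: "\<And>x. x \<in> ?K \<Longrightarrow> \<bar>\<phi> x\<bar> \<le> C"
    by (fastforce dest: compact_imp_bounded simp: bounded_iff)
  have "\<bar>\<phi> x\<bar> \<le> max C 0" for x
    using C[of x] closure_subset[of "{x. \<phi> x \<noteq> 0}"] by (cases "\<phi> x = 0") force+
  then show ?thesis by (rule that)
qed

lemma test_function_measurable:
  assumes "\<phi> \<in> test_functions U" shows "\<phi> \<in> borel_measurable (lebesgue_on S)"
proof -
  have "\<phi> \<in> borel_measurable borel"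
    using test_function_continuous[OF assms] by (rule borel_measurable_continuous_onI)
  then show ?thesis by (simp add: measurable_completion measurable_restrict_space1)
qed

lemma set_integrable_test_function:
  fixes h :: "real^'d \<Rightarrow> 'b::euclidean_space"
  assumes \<phi>: "\<phi> \<in> test_functions U" and h: "locally_integrable U h"
  shows "set_integrable lebesgue U (\<lambda>x. \<phi> x *\<^sub>R h x)"
proof -
  let ?K = "closure {x. \<phi> x \<noteq> 0}"
  have K: "compactly_in ?K U" using \<phi> by (simp add: test_functions_def)
  then have i: "integrable lebesgue (\<lambda>x. indicator ?K x *\<^sub>R h x)"
    using h unfolding locally_integrable_def set_integrable_def by blast
  obtain C where C: "\<And>x. \<bar>\<phi> x\<bar> \<le> C" using test_function_bounded[OF \<phi>] by blast
  have [measurable]: "\<phi> \<in> borel_measurable lebesgue"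
    using test_function_measurable[OF \<phi>, of UNIV] by (simp add: lebesgue_on_UNIV_eq)
  have "integrable lebesgue (\<lambda>x. \<phi> x *\<^sub>R (indicator ?K x *\<^sub>R h x))"
  proof (rule Bochner_Integration.integrable_bound)
    show "integrable lebesgue (\<lambda>x. C *\<^sub>R (indicator ?K x *\<^sub>R h x))"
      using i by (rule integrable_scaleR_right)
    show "(\<lambda>x. \<phi> x *\<^sub>R (indicator ?K x *\<^sub>R h x)) \<in> borel_measurable lebesgue"
      using borel_measurable_integrable[OF i] by measurable
    show "AE x in lebesgue. norm (\<phi> x *\<^sub>R indicator ?K x *\<^sub>R h x) \<le> norm (C *\<^sub>R indicator ?K x *\<^sub>R h x)"
    proof (rule AE_I2)
      fix x
      have "\<bar>\<phi> x\<bar> \<le> \<bar>C\<bar>" using C[of x] by linarith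
      then show "norm (\<phi> x *\<^sub>R indicator ?K x *\<^sub>R h x) \<le> norm (C *\<^sub>R indicator ?K x *\<^sub>R h x)"
        unfolding norm_scaleR by (rule mult_right_mono) simp
    qed
  qed
  moreover have "\<phi> x *\<^sub>R (indicator ?K x *\<^sub>R h x) = indicator U x *\<^sub>R \<phi> x *\<^sub>R h x" for x
  proof (cases "\<phi> x = 0")
    case False
    then have "x \<in> ?K" using closure_subset[of "{x. \<phi> x \<noteq> 0}"] by auto
    moreover from this have "x \<in> U" using K by (auto simp: compactly_in_def)
    ultimately show ?thesis by simp
  qed simp
  ultimately show ?thesis unfolding set_integrable_def by (simp only:)
qed

text \<open>Dominated convergence along \<^const>\<open>box_bump\<close>.\<close>

lemma integral_box_eq_0:
  fixes h :: "real^'d \<Rightarrow> 'b::euclidean_space"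
  assumes h: "locally_integrable U h" and ab: "cbox a b \<subseteq> U"
    and zero: "\<And>\<phi>. \<phi> \<in> test_functions U \<Longrightarrow> (LINT x:U|lebesgue. \<phi> x *\<^sub>R h x) = 0"
  shows "integral (cbox a b) h = 0"
proof -
  have i: "set_integrable lebesgue (cbox a b) h"
    using h ab by (simp add: locally_integrable_def compactly_in_def)
  then have ib: "set_integrable lebesgue (box a b) h"
    by (rule set_integrable_subset[OF _ _ box_subset_cbox]) simp
  have "(\<lambda>n. LINT x|lebesgue. box_bump a b n x *\<^sub>R (indicator (cbox a b) x *\<^sub>R h x))
      \<longlonglongrightarrow> (LINT x|lebesgue. indicator (box a b) x *\<^sub>R (indicator (cbox a b) x *\<^sub>R h x))"
  proof (rule integral_dominated_convergence[where w = "\<lambda>x. norm (indicator (cbox a b) x *\<^sub>R h x)"])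
    have h_meas: "(\<lambda>x. indicator (cbox a b) x *\<^sub>R h x) \<in> borel_measurable lebesgue"
      using i unfolding set_integrable_def by (rule borel_measurable_integrable)
    have bump_meas: "box_bump a b n \<in> borel_measurable lebesgue" for n
      using test_function_measurable[OF box_bump_test_function[OF ab], of n UNIV] by (simp add: lebesgue_on_UNIV_eq)
    show "(\<lambda>x. indicator (box a b) x *\<^sub>R (indicator (cbox a b) x *\<^sub>R h x)) \<in> borel_measurable lebesgue"
      by (intro borel_measurable_scaleR borel_measurable_indicator h_meas) auto
    show "(\<lambda>x. box_bump a b n x *\<^sub>R (indicator (cbox a b) x *\<^sub>R h x)) \<in> borel_measurable lebesgue" for n
      by (rule borel_measurable_scaleR[OF bump_meas h_meas])
    show "integrable lebesgue (\<lambda>x. norm (indicator (cbox a b) x *\<^sub>R h x))"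
      using i unfolding set_integrable_def by (rule integrable_norm)
    show "AE x in lebesgue. (\<lambda>n. box_bump a b n x *\<^sub>R (indicator (cbox a b) x *\<^sub>R h x))
        \<longlonglongrightarrow> indicator (box a b) x *\<^sub>R (indicator (cbox a b) x *\<^sub>R h x)"
      by (intro AE_I2 tendsto_scaleR box_bump_tendsto tendsto_const)
    show "AE x in lebesgue. norm (box_bump a b n x *\<^sub>R (indicator (cbox a b) x *\<^sub>R h x))
        \<le> norm (indicator (cbox a b) x *\<^sub>R h x)" for n
      by (intro AE_I2, subst norm_scaleR, rule mult_left_le_one_le) (simp_all add: box_bump_bound del: norm_scaleR)
  qed
  moreover have "(LINT x|lebesgue. box_bump a b n x *\<^sub>R (indicator (cbox a b) x *\<^sub>R h x)) = 0" for n
  proof -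
    have "box_bump a b n x *\<^sub>R (indicator (cbox a b) x *\<^sub>R h x) = indicator U x *\<^sub>R box_bump a b n x *\<^sub>R h x" for x
      using ab box_subset_cbox[of a b] by (cases "x \<in> box a b") (auto simp: box_bump_outside subset_iff)
    then show ?thesis
      using zero[OF box_bump_test_function[OF ab, of n]] unfolding set_lebesgue_integral_def by (simp only:)
  qed
  moreover have "indicator (box a b) x *\<^sub>R (indicator (cbox a b) x *\<^sub>R h x) = indicator (box a b) x *\<^sub>R h x" for x
    using box_subset_cbox[of a b] by (auto split: split_indicator)
  ultimately have "(LINT x:box a b|lebesgue. h x) = 0"
    unfolding set_lebesgue_integral_def by (simp only: LIMSEQ_const_iff)
  then show ?thesis
    using set_lebesgue_integral_eq_integral(2)[OF ib] by (simp add: integral_open_interval)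
qed

text \<open>The fundamental lemma of the calculus of variations. By the previous lemma the integral of \<open>h\<close>
  over every box inside \<open>U\<close> vanishes, and by Lebesgue differentiation \<open>h\<close> is almost everywhere
  the limit of its means over shrinking cubes.\<close>

lemma AE_eq_0_if_orthogonal_test_functions:
  fixes h :: "real^'d \<Rightarrow> 'b::euclidean_space"
  assumes U: "open U" and h: "locally_integrable U h"
    and zero: "\<And>\<phi>. \<phi> \<in> test_functions U \<Longrightarrow> (LINT x:U|lebesgue. \<phi> x *\<^sub>R h x) = 0"
  shows "AE x in lebesgue_on U. h x = 0"
proof -
  have cb: "AE x in lebesgue. x \<in> cbox a b \<longrightarrow> h x = 0" if ab: "cbox a b \<subseteq> U" for a b
  proof -
    \<comment> \<open>the differentiation theorem needs a function integrable on all boxes, so \<open>h\<close> is cut off\<close>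
    let ?f = "\<lambda>x. if x \<in> cbox a b then h x else 0"
    have "set_integrable lebesgue (cbox a b) h"
      using h ab by (simp add: locally_integrable_def compactly_in_def)
    then have "h integrable_on cbox a b" by (rule set_lebesgue_integral_eq_integral)
    then have "?f integrable_on UNIV" by (simp only: integrable_restrict_UNIV)
    then have "?f integrable_on cbox c d" for c d
      using integrable_on_subcbox subset_UNIV by blast
    from integrable_ccontinuous_explicit[OF this] obtain N where N: "negligible N"
      "\<And>x e. \<lbrakk>x \<notin> N; 0 < e\<rbrakk> \<Longrightarrow> \<exists>d>0. \<forall>k. 0 < k \<and> k < d \<longrightarrow>
          norm (integral (cbox x (x + k *\<^sub>R One)) ?f /\<^sub>R k ^ DIM(real^'d) - ?f x) < e"
      by blast
    have "h x = 0" if x: "x \<in> box a b" "x \<notin> N" for x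
    proof -
      have "x \<in> cbox a b" using x box_subset_cbox by blast
      have "norm (h x) < e" if "e > 0" for e
      proof -
        obtain d where d: "d > 0" "\<And>k. 0 < k \<Longrightarrow> k < d \<Longrightarrow>
            norm (integral (cbox x (x + k *\<^sub>R One)) ?f /\<^sub>R k ^ DIM(real^'d) - ?f x) < e"
          using N(2)[OF x(2) \<open>e > 0\<close>] by blast
        have "((\<lambda>k. x + k *\<^sub>R One) \<longlongrightarrow> x + 0 *\<^sub>R One) (at_right (0::real))"
          by (intro tendsto_intros)
        then have "\<forall>\<^sub>F k in at_right (0::real). x + k *\<^sub>R One \<in> box a b"
          using x(1) by (intro topological_tendstoD) auto
        moreover have "\<forall>\<^sub>F k in at_right (0::real). k \<in> {0<..<d}"
          using d(1) by (rule eventually_at_rightI[rotated]) auto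
        ultimately have "\<forall>\<^sub>F k in at_right (0::real). x + k *\<^sub>R One \<in> box a b \<and> k \<in> {0<..<d}"
          by (rule eventually_conj)
        then obtain k where k: "x + k *\<^sub>R One \<in> box a b" "0 < k" "k < d"
          using eventually_happens[of _ "at_right (0::real)"] by auto
        have sub: "cbox x (x + k *\<^sub>R One) \<subseteq> cbox a b"
          using k(1) x(1) unfolding subset_box(1) mem_box(1) by (meson less_imp_le)
        have "integral (cbox x (x + k *\<^sub>R One)) ?f = integral (cbox x (x + k *\<^sub>R One)) h"
          using sub by (intro Henstock_Kurzweil_Integration.integral_cong) auto
        also have "\<dots> = 0" using sub ab by (intro integral_box_eq_0[OF h _ zero]) auto
        finally show ?thesis using d(2)[OF k(2,3)] \<open>x \<in> cbox a b\<close> by simp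
      qed
      then show ?thesis using zero_less_norm_iff[of "h x"] by blast
    qed
    then have sub: "{x. \<not> (x \<in> cbox a b \<longrightarrow> h x = 0)} \<subseteq> N \<union> (cbox a b - box a b)" by auto
    have "negligible (N \<union> (cbox a b - box a b))"
      using N(1) negligible_frontier_interval by (rule negligible_Un)
    then have "N \<union> (cbox a b - box a b) \<in> null_sets lebesgue" by (simp add: negligible_iff_null_sets)
    then show ?thesis using sub by (intro AE_I'[of "N \<union> (cbox a b - box a b)"]) auto
  qed
  obtain \<D> where \<D>: "countable \<D>" "\<D> \<subseteq> Pow U" "\<And>X. X \<in> \<D> \<Longrightarrow> \<exists>a b. X = cbox a b" "\<Union>\<D> = U"
    using open_countable_Union_open_cbox[OF U] by metis
  have "AE x in lebesgue. \<forall>X\<in>\<D>. x \<in> X \<longrightarrow> h x = 0"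
  proof (subst AE_ball_countable[OF \<D>(1)], rule ballI)
    fix X assume X: "X \<in> \<D>"
    then obtain a b where "X = cbox a b" using \<D>(3) by blast
    then show "AE x in lebesgue. x \<in> X \<longrightarrow> h x = 0" using X \<D>(2) cb by blast
  qed
  then have "AE x in lebesgue. x \<in> U \<longrightarrow> h x = 0"
    by eventually_elim (use \<D>(4) in blast)
  then show ?thesis using U by (subst AE_restrict_space_iff) auto
qed

lemma has_weak_deriv_unique:
  assumes U: "open U" and g: "has_weak_deriv U i f g" and g': "has_weak_deriv U i f g'"
  shows "AE x in lebesgue_on U. g x = g' x"
proof -
  have li: "locally_integrable U g" "locally_integrable U g'"
    using g g' by (auto simp: has_weak_deriv_def)
  then have "locally_integrable U (\<lambda>x. g x - g' x)"
    unfolding locally_integrable_def using set_integral_diff(1) by blast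
  moreover have "(LINT x:U|lebesgue. \<phi> x *\<^sub>R (g x - g' x)) = 0" if \<phi>: "\<phi> \<in> test_functions U" for \<phi>
  proof -
    have "(LINT x:U|lebesgue. \<phi> x *\<^sub>R (g x - g' x)) =
        (LINT x:U|lebesgue. \<phi> x *\<^sub>R g x) - (LINT x:U|lebesgue. \<phi> x *\<^sub>R g' x)"
      using set_integral_diff(2)[OF set_integrable_test_function[OF \<phi> li(1)] set_integrable_test_function[OF \<phi> li(2)]]
      by (simp add: scaleR_diff_right)
    also have "\<dots> = 0" using g g' \<phi> by (auto simp: has_weak_deriv_def)
    finally show ?thesis .
  qed
  ultimately have "AE x in lebesgue_on U. g x - g' x = 0"
    by (rule AE_eq_0_if_orthogonal_test_functions[OF U])
  then show ?thesis by simp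
qed

text \<open>A weak derivative chosen by \<^const>\<open>weak_deriv\<close> is one as soon as some weak derivative exists; by
  uniqueness it agrees almost everywhere with any other.\<close>

lemma has_weak_deriv_weak_deriv:
  assumes "has_weak_deriv U i f g" shows "has_weak_deriv U i f (weak_deriv U i f)"
  unfolding weak_deriv_def using assms by (rule someI[of "has_weak_deriv U i f"])

section \<open>Essentially bounded functions and series of weak derivatives\<close>

lemma set_integrable_lebesgue_on:
  fixes f :: "'a::euclidean_space \<Rightarrow> 'b::euclidean_space"
  assumes "U \<in> sets lebesgue"
  shows "set_integrable lebesgue U f \<longleftrightarrow> integrable (lebesgue_on U) f"
  using assms by (simp add: set_integrable_def integrable_restrict_space)

lemma set_lebesgue_integral_lebesgue_on:
  fixes f :: "'a::euclidean_space \<Rightarrow> 'b::euclidean_space"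
  assumes "U \<in> sets lebesgue"
  shows "(LINT x:U|lebesgue. f x) = (LINT x|lebesgue_on U. f x)"
  using assms by (simp add: set_lebesgue_integral_def integral_restrict_space)

text \<open>Lebesgue measure is complete, so almost everywhere equality preserves measurability.\<close>

lemma borel_measurable_lebesgue_on_AE:
  fixes f :: "'a::euclidean_space \<Rightarrow> 'b::euclidean_space"
  assumes U: "U \<in> sets lebesgue" and f: "f \<in> borel_measurable (lebesgue_on U)"
    and eq: "AE x in lebesgue_on U. f x = g x"
  shows "g \<in> borel_measurable (lebesgue_on U)"
proof -
  have "AE x in lebesgue. x \<in> U \<longrightarrow> f x = g x"
    using eq U by (simp add: AE_restrict_space_iff)
  then have "AE x in lebesgue. (if x \<in> U then f x else 0) = (if x \<in> U then g x else 0)"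
    by eventually_elim auto
  moreover have "(\<lambda>x. if x \<in> U then f x else 0) \<in> borel_measurable lebesgue"
    using f by (simp add: borel_measurable_if[OF U])
  ultimately have "(\<lambda>x. if x \<in> U then g x else 0) \<in> borel_measurable lebesgue"
    by (rule borel_measurable_AE[rotated])
  then show ?thesis by (simp add: borel_measurable_if[OF U])
qed

lemma LinfI:
  fixes f :: "real^'d \<Rightarrow> 'b::euclidean_space"
  assumes "f \<in> borel_measurable (lebesgue_on U)" "AE x in lebesgue_on U. norm (f x) \<le> c"
  shows "f \<in> Linf U"
proof -
  have "Linf_norm U f \<le> ennreal c"
    unfolding Linf_norm_def
    by (rule esssup_I) (use assms in \<open>auto elim!: eventually_mono intro: ennreal_leI\<close>)
  then show ?thesis using assms(1) by (auto simp: Linf_def intro: le_less_trans)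
qed

text \<open>A finite essential supremum is an almost everywhere bound. No measurability is assumed: the essential
  supremum of a non-measurable function is \<open>\<infinity>\<close>, which the hypothesis excludes.\<close>

lemma AE_le_enn2real_esssup:
  assumes "esssup M (\<lambda>x. ennreal (f x)) < \<infinity>" "\<And>x. 0 \<le> f x"
  shows "AE x in M. f x \<le> enn2real (esssup M (\<lambda>x. ennreal (f x)))"
  using esssup_AE[of "\<lambda>x. ennreal (f x)" M]
proof eventually_elim
  case (elim x)
  then show ?case using enn2real_mono[OF elim] assms by simp
qed

lemma Linf_AE_bound:
  fixes f :: "real^'d \<Rightarrow> 'b::euclidean_space"
  assumes "f \<in> Linf U"
  shows "AE x in lebesgue_on U. norm (f x) \<le> enn2real (Linf_norm U f)"
  using assms AE_le_enn2real_esssup[of "lebesgue_on U" "\<lambda>x. norm (f x)"]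
  by (auto simp: Linf_def Linf_norm_def)

lemma Linf_measurable: "f \<in> Linf U \<Longrightarrow> f \<in> borel_measurable (lebesgue_on U)"
  by (simp add: Linf_def)

lemma Linf_scaleR:
  fixes f :: "real^'d \<Rightarrow> 'b::euclidean_space"
  assumes "f \<in> Linf U" shows "(\<lambda>x. c *\<^sub>R f x) \<in> Linf U"
proof (rule LinfI)
  show "(\<lambda>x. c *\<^sub>R f x) \<in> borel_measurable (lebesgue_on U)"
    using Linf_measurable[OF assms] by simp
  show "AE x in lebesgue_on U. norm (c *\<^sub>R f x) \<le> \<bar>c\<bar> * enn2real (Linf_norm U f)"
    using Linf_AE_bound[OF assms] by eventually_elim (simp add: mult_left_mono)
qed

lemma Linf_add:
  fixes f g :: "real^'d \<Rightarrow> 'b::euclidean_space"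
  assumes "f \<in> Linf U" "g \<in> Linf U" shows "(\<lambda>x. f x + g x) \<in> Linf U"
proof (rule LinfI)
  show "(\<lambda>x. f x + g x) \<in> borel_measurable (lebesgue_on U)"
    using assms[THEN Linf_measurable] by simp
  show "AE x in lebesgue_on U. norm (f x + g x) \<le> enn2real (Linf_norm U f) + enn2real (Linf_norm U g)"
    using Linf_AE_bound[OF assms(1)] Linf_AE_bound[OF assms(2)]
    by eventually_elim (rule norm_triangle_mono)
qed

lemma AE_norm_le_all:
  assumes "\<And>j::nat. AE x in M. norm (F j x) \<le> c j"
  shows "AE x in M. \<forall>j. norm (F j x) \<le> c j"
  using assms by (simp add: AE_all_countable)

lemma Linf_suminf:
  fixes F :: "nat \<Rightarrow> real^'d \<Rightarrow> 'b::euclidean_space"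
  assumes F: "\<And>j. F j \<in> Linf U" and b: "\<And>j. AE x in lebesgue_on U. norm (F j x) \<le> c j"
    and c: "summable c"
  shows "(\<lambda>x. \<Sum>j. F j x) \<in> Linf U"
proof (rule LinfI)
  show "(\<lambda>x. \<Sum>j. F j x) \<in> borel_measurable (lebesgue_on U)"
    using F[THEN Linf_measurable] by (rule borel_measurable_suminf)
  show "AE x in lebesgue_on U. norm (\<Sum>j. F j x) \<le> suminf c"
    using AE_norm_le_all[OF b]
    by eventually_elim (use c in \<open>auto intro: norm_suminf_le\<close>)
qed

lemma Linf_locally_integrable:
  fixes f :: "real^'d \<Rightarrow> 'b::euclidean_space"
  assumes U: "open U" and f: "f \<in> Linf U" shows "locally_integrable U f"
  unfolding locally_integrable_def
proof (intro allI impI)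
  fix K assume "compactly_in K U"
  then have K: "compact K" "K \<subseteq> U" by (auto simp: compactly_in_def)
  have m: "(\<lambda>x. indicator U x *\<^sub>R f x) \<in> borel_measurable lebesgue"
    using Linf_measurable[OF f] U by (simp add: borel_measurable_restrict_space_iff)
  have "AE x in lebesgue. x \<in> U \<longrightarrow> norm (f x) \<le> enn2real (Linf_norm U f)"
    using Linf_AE_bound[OF f] U by (simp add: AE_restrict_space_iff)
  then have "AE x in lebesgue. x \<in> K \<longrightarrow> norm (indicator U x *\<^sub>R f x) \<le> enn2real (Linf_norm U f)"
    by eventually_elim (use K in auto)
  then have "integrable lebesgue (\<lambda>x. indicator K x *\<^sub>R (indicator U x *\<^sub>R f x))"
    using K(1) m by (intro integrableI_bounded_set_indicator)
      (auto simp: compact_imp_closed emeasure_bounded_finite[OF compact_imp_bounded, simplified])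
  moreover have "indicator K x *\<^sub>R (indicator U x *\<^sub>R f x) = indicator K x *\<^sub>R f x" for x
    using K(2) by (auto split: split_indicator)
  ultimately show "set_integrable lebesgue K f"
    unfolding set_integrable_def by (simp only:)
qed

lemma has_weak_deriv_add:
  assumes "has_weak_deriv U i f f'" "has_weak_deriv U i g g'"
  shows "has_weak_deriv U i (\<lambda>x. f x + g x) (\<lambda>x. f' x + g' x)"
proof -
  have li: "locally_integrable U f" "locally_integrable U f'"
    "locally_integrable U g" "locally_integrable U g'"
    using assms by (auto simp: has_weak_deriv_def)
  have add: "(LINT x:U|lebesgue. \<phi> x *\<^sub>R (h x + k x)) =
      (LINT x:U|lebesgue. \<phi> x *\<^sub>R h x) + (LINT x:U|lebesgue. \<phi> x *\<^sub>R k x)"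
    if "\<phi> \<in> test_functions U" "locally_integrable U h" "locally_integrable U k"
    for \<phi> and h k :: "real^'a \<Rightarrow> 'b"
    using set_integral_add(2)[OF set_integrable_test_function[OF that(1,2)] set_integrable_test_function[OF that(1,3)]]
    by (simp only: scaleR_add_right)
  show ?thesis
    unfolding has_weak_deriv_def
  proof (intro conjI ballI)
    show "locally_integrable U (\<lambda>x. f x + g x)" "locally_integrable U (\<lambda>x. f' x + g' x)"
      using li set_integral_add(1) unfolding locally_integrable_def by blast+
    fix \<phi> assume \<phi>: "\<phi> \<in> test_functions U"
    show "(LINT x:U|lebesgue. partial_deriv i \<phi> x *\<^sub>R (f x + g x)) =
        - (LINT x:U|lebesgue. \<phi> x *\<^sub>R (f' x + g' x))"
      using assms \<phi> by (simp add: add[OF test_functions_partial_deriv] add li has_weak_deriv_def)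
  qed
qed

lemma has_weak_deriv_scaleR:
  assumes "has_weak_deriv U i f f'"
  shows "has_weak_deriv U i (\<lambda>x. c *\<^sub>R f x) (\<lambda>x. c *\<^sub>R f' x)"
proof -
  have li: "locally_integrable U f" "locally_integrable U f'"
    using assms by (auto simp: has_weak_deriv_def)
  have *: "(LINT x:U|lebesgue. \<phi> x *\<^sub>R (c *\<^sub>R h x)) = c *\<^sub>R (LINT x:U|lebesgue. \<phi> x *\<^sub>R h x)"
    for \<phi> and h :: "real^'a \<Rightarrow> 'b"
    by (subst scaleR_left_commute) (rule set_integral_scaleR_right)
  show ?thesis
    unfolding has_weak_deriv_def *
  proof (intro conjI ballI)
    show "locally_integrable U (\<lambda>x. c *\<^sub>R f x)" "locally_integrable U (\<lambda>x. c *\<^sub>R f' x)"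
      using li set_integrable_scaleR_right unfolding locally_integrable_def by blast+
    fix \<phi> assume \<phi>: "\<phi> \<in> test_functions U"
    then show "c *\<^sub>R (LINT x:U|lebesgue. partial_deriv i \<phi> x *\<^sub>R f x) =
        - (c *\<^sub>R (LINT x:U|lebesgue. \<phi> x *\<^sub>R f' x))"
      using assms by (simp add: has_weak_deriv_def)
  qed
qed

text \<open>Integration against a test function may be interchanged with a series whose terms have summable
  essential bounds.\<close>

lemma sums_integral_test_function:
  fixes F :: "nat \<Rightarrow> real^'d \<Rightarrow> 'b::euclidean_space"
  assumes U: "open U" and \<phi>: "\<phi> \<in> test_functions U"
    and F: "\<And>j. F j \<in> Linf U" and b: "\<And>j. AE x in lebesgue_on U. norm (F j x) \<le> c j"
    and c: "summable c"
  shows "(\<lambda>j. LINT x:U|lebesgue. \<phi> x *\<^sub>R F j x) sums (LINT x:U|lebesgue. \<phi> x *\<^sub>R (\<Sum>j. F j x))"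
proof -
  have Us: "U \<in> sets lebesgue" using U by simp
  have "locally_integrable U (\<lambda>_. 1::real)"
    by (rule Linf_locally_integrable[OF U], rule LinfI[where c = 1]) auto
  from set_integrable_test_function[OF \<phi> this]
  have \<phi>i: "integrable (lebesgue_on U) \<phi>" by (simp add: set_integrable_lebesgue_on[OF Us])
  have i: "integrable (lebesgue_on U) (\<lambda>x. \<phi> x *\<^sub>R F j x)" for j
    using set_integrable_test_function[OF \<phi> Linf_locally_integrable[OF U F]]
    by (simp add: set_integrable_lebesgue_on[OF Us])
  have all: "AE x in lebesgue_on U. \<forall>j. norm (F j x) \<le> c j" using b by (rule AE_norm_le_all)
  have "(LINT x|lebesgue_on U. \<phi> x *\<^sub>R (\<Sum>j. F j x)) = (LINT x|lebesgue_on U. (\<Sum>j. \<phi> x *\<^sub>R F j x))"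
  proof (rule integral_cong_AE)
    show "AE x in lebesgue_on U. \<phi> x *\<^sub>R (\<Sum>j. F j x) = (\<Sum>j. \<phi> x *\<^sub>R F j x)"
      using all
    proof eventually_elim
      case (elim x)
      have "summable (\<lambda>j. F j x)" using elim by (intro summable_comparison_test'[OF c]) auto
      then show ?case by (rule suminf_scaleR_right)
    qed
    show "(\<lambda>x. \<phi> x *\<^sub>R (\<Sum>j. F j x)) \<in> borel_measurable (lebesgue_on U)"
      by (intro borel_measurable_scaleR test_function_measurable[OF \<phi>] Linf_measurable[OF Linf_suminf[OF F b c]])
    show "(\<lambda>x. \<Sum>j. \<phi> x *\<^sub>R F j x) \<in> borel_measurable (lebesgue_on U)"
      using i[THEN borel_measurable_integrable] by (rule borel_measurable_suminf)
  qed
  moreover have "(\<lambda>j. LINT x|lebesgue_on U. \<phi> x *\<^sub>R F j x) sums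
      (LINT x|lebesgue_on U. (\<Sum>j. \<phi> x *\<^sub>R F j x))"
  proof (rule sums_integral[OF i])
    show "AE x in lebesgue_on U. summable (\<lambda>j. norm (\<phi> x *\<^sub>R F j x))"
      using all
    proof eventually_elim
      case (elim x)
      have "summable (\<lambda>j. norm (F j x))" using elim by (intro summable_comparison_test'[OF c]) auto
      then show ?case by (simp add: summable_mult)
    qed
    show "summable (\<lambda>j. LINT x|lebesgue_on U. norm (\<phi> x *\<^sub>R F j x))"
    proof (rule summable_comparison_test')
      show "summable (\<lambda>j. (LINT x|lebesgue_on U. \<bar>\<phi> x\<bar>) * c j)" using c by (rule summable_mult)
      fix j
      have "(LINT x|lebesgue_on U. norm (\<phi> x *\<^sub>R F j x)) \<le> (LINT x|lebesgue_on U. \<bar>\<phi> x\<bar> * c j)"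
      proof (rule integral_mono_AE)
        show "integrable (lebesgue_on U) (\<lambda>x. norm (\<phi> x *\<^sub>R F j x))" using i by (rule integrable_norm)
        show "integrable (lebesgue_on U) (\<lambda>x. \<bar>\<phi> x\<bar> * c j)" using \<phi>i by simp
        show "AE x in lebesgue_on U. norm (\<phi> x *\<^sub>R F j x) \<le> \<bar>\<phi> x\<bar> * c j"
          using b[of j] by eventually_elim (simp add: mult_left_mono)
      qed
      then show "norm (LINT x|lebesgue_on U. norm (\<phi> x *\<^sub>R F j x)) \<le> (LINT x|lebesgue_on U. \<bar>\<phi> x\<bar>) * c j"
        by (simp add: abs_of_nonneg[OF Bochner_Integration.integral_nonneg])
    qed
  qed
  ultimately show ?thesis by (simp only: set_lebesgue_integral_lebesgue_on[OF Us])
qed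

lemma has_weak_deriv_suminf:
  fixes F G :: "nat \<Rightarrow> real^'d \<Rightarrow> 'b::euclidean_space"
  assumes U: "open U" and d: "\<And>j. has_weak_deriv U i (F j) (G j)"
    and F: "\<And>j. F j \<in> Linf U" "\<And>j. AE x in lebesgue_on U. norm (F j x) \<le> c j" "summable c"
    and G: "\<And>j. G j \<in> Linf U" "\<And>j. AE x in lebesgue_on U. norm (G j x) \<le> c' j" "summable c'"
  shows "has_weak_deriv U i (\<lambda>x. \<Sum>j. F j x) (\<lambda>x. \<Sum>j. G j x)"
  unfolding has_weak_deriv_def
proof (intro conjI ballI)
  show "locally_integrable U (\<lambda>x. \<Sum>j. F j x)" "locally_integrable U (\<lambda>x. \<Sum>j. G j x)"
    using Linf_locally_integrable[OF U] Linf_suminf[OF F] Linf_suminf[OF G] by blast+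
  fix \<phi> assume \<phi>: "\<phi> \<in> test_functions U"
  have d': "(LINT x:U|lebesgue. partial_deriv i \<phi> x *\<^sub>R F j x) = - (LINT x:U|lebesgue. \<phi> x *\<^sub>R G j x)" for j
    using d \<phi> by (simp add: has_weak_deriv_def)
  show "(LINT x:U|lebesgue. partial_deriv i \<phi> x *\<^sub>R (\<Sum>j. F j x)) =
      - (LINT x:U|lebesgue. \<phi> x *\<^sub>R (\<Sum>j. G j x))"
    using sums_integral_test_function[OF U test_functions_partial_deriv[OF \<phi>, of i] F]
      sums_minus[OF sums_integral_test_function[OF U \<phi> G]]
    unfolding d' by (rule sums_unique2)
qed

section \<open>Quadratic forms of matrices\<close>

text \<open>A real quadratic form on complex vectors splits into its values on real and imaginary parts. This
  needs no symmetry, because only the real part enters \<^const>\<open>form_ge\<close>.\<close>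

lemma form_ge_iff_real: "form_ge M c \<longleftrightarrow> (\<forall>v. c * (norm v)\<^sup>2 \<le> (M *v v) \<bullet> v)"
proof -
  let ?re = "\<lambda>\<xi>::complex^'a. \<chi> i. Re (\<xi> $ i)" and ?im = "\<lambda>\<xi>::complex^'a. \<chi> i. Im (\<xi> $ i)"
  let ?q = "\<lambda>\<xi>. Re (\<Sum>i\<in>UNIV. (map_matrix complex_of_real M *v \<xi>) $ i * cnj (\<xi> $ i))"
  have q: "?q \<xi> = (M *v ?re \<xi>) \<bullet> ?re \<xi> + (M *v ?im \<xi>) \<bullet> ?im \<xi>" for \<xi>
    by (simp add: matrix_vector_mult_def inner_vec_def map_matrix_def sum.distrib[symmetric]
        sum_distrib_right algebra_simps)
  have n: "(norm \<xi>)\<^sup>2 = (norm (?re \<xi>))\<^sup>2 + (norm (?im \<xi>))\<^sup>2" for \<xi>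
    by (simp add: norm_vec_def L2_set_def sum_nonneg cmod_power2 sum.distrib)
  show ?thesis
  proof
    assume M: "form_ge M c"
    show "\<forall>v. c * (norm v)\<^sup>2 \<le> (M *v v) \<bullet> v"
    proof
      fix v :: "real^'a"
      let ?\<xi> = "\<chi> i. complex_of_real (v $ i)"
      have "?re ?\<xi> = v" "?im ?\<xi> = 0" by (simp_all add: vec_eq_iff)
      moreover have "c * (norm ?\<xi>)\<^sup>2 \<le> ?q ?\<xi>" using M unfolding form_ge_def by blast
      ultimately show "c * (norm v)\<^sup>2 \<le> (M *v v) \<bullet> v" unfolding q n by simp
    qed
  next
    assume R: "\<forall>v. c * (norm v)\<^sup>2 \<le> (M *v v) \<bullet> v"
    show "form_ge M c"
      unfolding form_ge_def q n using add_mono[OF R[rule_format] R[rule_format]]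
      by (simp add: distrib_left)
  qed
qed

lemma form_ge_mono: "c \<le> c' \<Longrightarrow> form_ge M c' \<Longrightarrow> form_ge M c"
  unfolding form_ge_iff_real by (meson mult_right_mono order_trans zero_le_power2)

lemma spectral_norm_nonneg: "0 \<le> spectral_norm M"
  unfolding spectral_norm_def by (rule onorm_pos_le) simp

lemma abs_quadratic_form_le: "\<bar>(M *v v) \<bullet> v\<bar> \<le> spectral_norm M * (norm v)\<^sup>2"
proof -
  have "\<bar>(M *v v) \<bullet> v\<bar> \<le> norm (M *v v) * norm v" by (rule Cauchy_Schwarz_ineq2)
  also have "\<dots> \<le> (spectral_norm M * norm v) * norm v"
    unfolding spectral_norm_def by (intro mult_right_mono onorm) auto
  finally show ?thesis by (simp add: power2_eq_square mult.assoc)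
qed

lemma bounded_linear_quadratic_form: "bounded_linear (\<lambda>M::real^'n^'n. (M *v v) \<bullet> v)"
proof -
  have "linear (\<lambda>M::real^'n^'n. (M *v v) \<bullet> v)"
    by (rule linearI) (simp_all add: matrix_vector_mult_add_rdistrib inner_add_left flip: scaleR_matrix_vector_assoc)
  then show ?thesis by (simp add: linear_conv_bounded_linear)
qed

text \<open>The perturbation estimate behind both lower bounds in the theorem: a series whose coefficients are at
  most \<open>r\<close> in modulus lowers the quadratic form by at most \<open>r\<close> times the sum of
  bounds on the spectral norms.\<close>

lemma form_ge_add_suminf:
  fixes N :: "nat \<Rightarrow> real^'n^'n"
  assumes M: "form_ge M c" and N: "\<And>j. spectral_norm (N j) \<le> s j" and s: "summable s"
    and y: "\<And>j. \<bar>y j\<bar> \<le> r" and sum: "summable (\<lambda>j. y j *\<^sub>R N j)"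
  shows "form_ge (M + (\<Sum>j. y j *\<^sub>R N j)) (c - r * suminf s)"
  unfolding form_ge_iff_real
proof
  fix v :: "real^'n"
  interpret q: bounded_linear "\<lambda>M::real^'n^'n. (M *v v) \<bullet> v" by (rule bounded_linear_quadratic_form)
  have "\<bar>\<Sum>j. (y j *\<^sub>R N j *v v) \<bullet> v\<bar> \<le> (\<Sum>j. r * (norm v)\<^sup>2 * s j)"
  proof (rule norm_suminf_le[where 'a = real, unfolded real_norm_def])
    fix j
    have "\<bar>(y j *\<^sub>R N j *v v) \<bullet> v\<bar> = \<bar>y j\<bar> * \<bar>(N j *v v) \<bullet> v\<bar>"
      by (simp add: q.scaleR abs_mult)
    also have "\<dots> \<le> r * (s j * (norm v)\<^sup>2)"
    proof (rule mult_mono)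
      show "\<bar>(N j *v v) \<bullet> v\<bar> \<le> s j * (norm v)\<^sup>2"
        using abs_quadratic_form_le[of "N j" v] mult_right_mono[OF N[of j], of "(norm v)\<^sup>2"] by simp
    qed (use y[of j] in auto)
    finally show "\<bar>(y j *\<^sub>R N j *v v) \<bullet> v\<bar> \<le> r * (norm v)\<^sup>2 * s j" by (simp add: mult_ac)
  qed (use s in \<open>rule summable_mult\<close>)
  also have "\<dots> = r * suminf s * (norm v)\<^sup>2" using suminf_mult[OF s, of "r * (norm v)\<^sup>2"] by (simp add: mult_ac)
  finally have "\<bar>((\<Sum>j. y j *\<^sub>R N j) *v v) \<bullet> v\<bar> \<le> r * suminf s * (norm v)\<^sup>2"
    by (simp add: q.suminf[OF sum])
  moreover have "c * (norm v)\<^sup>2 \<le> (M *v v) \<bullet> v" using M by (simp add: form_ge_iff_real)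
  ultimately show "(c - r * suminf s) * (norm v)\<^sup>2 \<le> ((M + (\<Sum>j. y j *\<^sub>R N j)) *v v) \<bullet> v"
    unfolding q.add left_diff_distrib by linarith
qed

lemma symmetric_matrix_suminf:
  assumes "\<And>j. symmetric_matrix (N j)" "summable N"
  shows "symmetric_matrix (suminf N)"
proof -
  have S: "(\<lambda>j. N j $ a $ b) sums (suminf N $ a $ b)" for a b
    by (intro bounded_linear.sums[OF bounded_linear_vec_nth] summable_sums assms)
  have sym: "N j $ b $ a = N j $ a $ b" for j a b
    using arg_cong[OF assms(1)[of j, unfolded symmetric_matrix_def], of "\<lambda>M. M $ a $ b"]
    by (simp add: transpose_def)
  have "suminf N $ b $ a = suminf N $ a $ b" for a b
    using sums_unique2[OF S[of b a, unfolded sym[of _ b a]] S[of a b]] .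
  then show ?thesis by (simp add: symmetric_matrix_def transpose_def vec_eq_iff)
qed

lemma SPD_if_form_ge:
  assumes "symmetric_matrix M" "form_ge M c" "c > 0" shows "M \<in> SPD"
proof -
  have "0 < (M *v v) \<bullet> v" if "v \<noteq> 0" for v
    using assms(2,3) that form_ge_iff_real[of M c] by (smt (verit) mult_pos_pos zero_less_norm_iff zero_less_power)
  then show ?thesis using assms(1) by (simp add: SPD_def)
qed

lemma suminf_ennreal_finite:
  assumes "(\<Sum>j. e j) < (\<infinity>::ennreal)"
  shows "summable (\<lambda>j. enn2real (e j))" "(\<Sum>j. e j) = ennreal (\<Sum>j. enn2real (e j))"
    "e j < \<infinity>"
proof -
  have fin: "e j < \<infinity>" for j using assms ennreal_suminf_lessD by blast
  then have e: "e = (\<lambda>j. ennreal (enn2real (e j)))" by (auto simp: fun_eq_iff)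
  have ne: "(\<Sum>j. ennreal (enn2real (e j))) \<noteq> top" using assms e by simp
  show "summable (\<lambda>j. enn2real (e j))" by (rule summable_suminf_not_top[OF _ ne]) simp
  show "(\<Sum>j. e j) = ennreal (\<Sum>j. enn2real (e j))" using suminf_ennreal[OF _ ne] e by simp
  show "e j < \<infinity>" by (rule fin)
qed

section \<open>Series of \<open>W\<^sup>1\<^sup>,\<^sup>\<infinity>\<close> functions and the class \<open>NT\<^sub>A\<close>\<close>

text \<open>The chosen weak derivative need not be the bounded one that membership in \<open>W\<^sup>1\<^sup>,\<^sup>\<infinity>\<close> provides, but
  it agrees with it almost everywhere.\<close>

lemma W1inf_weak_deriv:
  fixes f :: "real^'d \<Rightarrow> 'b::euclidean_space"
  assumes U: "open U" and f: "f \<in> W1inf U"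
  shows "has_weak_deriv U i f (weak_deriv U i f)" "weak_deriv U i f \<in> Linf U"
proof -
  obtain g where g: "g \<in> Linf U" "has_weak_deriv U i f g"
    using f unfolding W1inf_def by blast
  show d: "has_weak_deriv U i f (weak_deriv U i f)"
    using g(2) by (rule has_weak_deriv_weak_deriv)
  have eq: "AE x in lebesgue_on U. g x = weak_deriv U i f x"
    using U g(2) d by (rule has_weak_deriv_unique)
  show "weak_deriv U i f \<in> Linf U"
  proof (rule LinfI)
    show "weak_deriv U i f \<in> borel_measurable (lebesgue_on U)"
      using U by (intro borel_measurable_lebesgue_on_AE[OF _ Linf_measurable[OF g(1)] eq]) simp
    show "AE x in lebesgue_on U. norm (weak_deriv U i f x) \<le> enn2real (Linf_norm U g)"
      using eq Linf_AE_bound[OF g(1)] by eventually_elim simp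
  qed
qed

lemma Linf_scaled_series:
  fixes F :: "nat \<Rightarrow> real^'d \<Rightarrow> 'b::euclidean_space"
  assumes F: "\<And>j. F j \<in> Linf U" and fin: "(\<Sum>j. Linf_norm U (F j)) < \<infinity>"
    and y: "\<And>j. \<bar>y j\<bar> \<le> (1::real)"
  defines "c \<equiv> \<lambda>j. enn2real (Linf_norm U (F j))"
  shows "\<And>j. (\<lambda>x. y j *\<^sub>R F j x) \<in> Linf U"
    "\<And>j. AE x in lebesgue_on U. norm (y j *\<^sub>R F j x) \<le> c j" "summable c"
    "AE x in lebesgue_on U. summable (\<lambda>j. y j *\<^sub>R F j x)"
proof -
  show "(\<lambda>x. y j *\<^sub>R F j x) \<in> Linf U" for j using F by (rule Linf_scaleR)
  show b: "AE x in lebesgue_on U. norm (y j *\<^sub>R F j x) \<le> c j" for j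
    using Linf_AE_bound[OF F[of j]]
  proof eventually_elim
    case (elim x)
    then show ?case using mult_mono[OF y[of j] elim] by (simp add: c_def)
  qed
  show c: "summable c" unfolding c_def using fin by (rule suminf_ennreal_finite)
  show "AE x in lebesgue_on U. summable (\<lambda>j. y j *\<^sub>R F j x)"
    using AE_norm_le_all[where F = "\<lambda>j x. y j *\<^sub>R F j x" and c = c, OF b]
    by eventually_elim (use c in \<open>auto intro: summable_comparison_test'\<close>)
qed

text \<open>Absolutely convergent series in \<open>W\<^sup>1\<^sup>,\<^sup>\<infinity>\<close> may be differentiated term by term. The identity for
  \<^const>\<open>radial_deriv\<close> concerns arbitrarily chosen representatives of the weak derivatives, so it rests
  on their almost everywhere uniqueness.\<close>

lemma W1inf_add_series:
  fixes f :: "real^'d \<Rightarrow> 'b::euclidean_space"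
  assumes U: "open U" and f: "f \<in> W1inf U" and F: "\<And>j. F j \<in> W1inf U"
    and fin: "(\<Sum>j. W1inf_norm U (F j)) < \<infinity>" and y: "\<And>j. \<bar>y j\<bar> \<le> (1::real)"
  defines "B \<equiv> \<lambda>x. f x + (\<Sum>j. y j *\<^sub>R F j x)"
  shows "B \<in> W1inf U"
    "AE x in lebesgue_on U. summable (\<lambda>j. y j *\<^sub>R F j x)"
    "AE x in lebesgue_on U. (\<lambda>j. y j *\<^sub>R radial_deriv U (F j) x) sums
       (radial_deriv U B x - radial_deriv U f x)"
proof -
  have FL: "F j \<in> Linf U" for j using F by (simp add: W1inf_def)
  have "Linf_norm U (F j) \<le> W1inf_norm U (F j)" for j by (simp add: W1inf_norm_def)
  then have "(\<Sum>j. Linf_norm U (F j)) < \<infinity>"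
    using fin by (meson suminf_le summableI le_less_trans)
  note sF = Linf_scaled_series[where F = F and y = y, OF FL this y]
  have "Linf_norm U (weak_deriv U i (F j)) \<le> W1inf_norm U (F j)" for i j
    unfolding W1inf_norm_def
    using member_le_sum[of i UNIV "\<lambda>i. Linf_norm U (weak_deriv U i (F j))"]
    by (simp add: add_increasing)
  then have "(\<Sum>j. Linf_norm U (weak_deriv U i (F j))) < \<infinity>" for i
    using fin by (meson suminf_le summableI le_less_trans)
  note sG = Linf_scaled_series[where F = "\<lambda>j. weak_deriv U i (F j)" and y = y for i,
      OF W1inf_weak_deriv(2)[OF U F] this y]
  let ?G = "\<lambda>i x. weak_deriv U i f x + (\<Sum>j. y j *\<^sub>R weak_deriv U i (F j) x)"
  have d: "has_weak_deriv U i B (?G i)" for i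
    unfolding B_def
    by (intro has_weak_deriv_add W1inf_weak_deriv[OF U f]
        has_weak_deriv_suminf[OF U has_weak_deriv_scaleR[OF W1inf_weak_deriv(1)[OF U F]] sF(1-3) sG(1-3)])
  have "B \<in> Linf U"
    unfolding B_def using f by (intro Linf_add Linf_suminf[OF sF(1-3)]) (simp add: W1inf_def)
  moreover have "?G i \<in> Linf U" for i
    by (intro Linf_add Linf_suminf[OF sG(1-3)] W1inf_weak_deriv[OF U f])
  ultimately show "B \<in> W1inf U" using d unfolding W1inf_def by blast
  show "AE x in lebesgue_on U. summable (\<lambda>j. y j *\<^sub>R F j x)" by (rule sF(4))
  have "AE x in lebesgue_on U. \<forall>i. weak_deriv U i B x = ?G i x"
    using has_weak_deriv_unique[OF U has_weak_deriv_weak_deriv[OF d] d]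
    by (rule eventually_all_finite)
  moreover have "AE x in lebesgue_on U. \<forall>i. summable (\<lambda>j. y j *\<^sub>R weak_deriv U i (F j) x)"
    using sG(4) by (rule eventually_all_finite)
  ultimately show "AE x in lebesgue_on U. (\<lambda>j. y j *\<^sub>R radial_deriv U (F j) x) sums
       (radial_deriv U B x - radial_deriv U f x)"
  proof eventually_elim
    case (elim x)
    have "(\<lambda>j. \<Sum>i\<in>UNIV. x $ i *\<^sub>R (y j *\<^sub>R weak_deriv U i (F j) x)) sums
        (\<Sum>i\<in>UNIV. x $ i *\<^sub>R (\<Sum>j. y j *\<^sub>R weak_deriv U i (F j) x))"
      using elim(2) by (intro sums_sum sums_scaleR_right summable_sums) auto
    moreover have "(\<Sum>i\<in>UNIV. x $ i *\<^sub>R (y j *\<^sub>R weak_deriv U i (F j) x)) = y j *\<^sub>R radial_deriv U (F j) x" for j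
      by (simp add: radial_deriv_def scaleR_sum_right mult.commute)
    moreover have "(\<Sum>i\<in>UNIV. x $ i *\<^sub>R (\<Sum>j. y j *\<^sub>R weak_deriv U i (F j) x)) =
        radial_deriv U B x - radial_deriv U f x"
      using elim(1) by (simp add: radial_deriv_def scaleR_add_right sum.distrib)
    ultimately show ?case by (simp only:)
  qed
qed

lemma open_D_R: "open (D_R Dm R)"
proof -
  have "open (D_plus Dm)" unfolding D_plus_def by (intro open_Diff) auto
  then show ?thesis unfolding D_R_def by (intro open_Int) auto
qed

lemma AE_abs_le_half_if_uniform:
  assumes "Y \<in> borel_measurable P" "distr P borel Y = uniform_measure lborel {-1/2<..<1/2}"
  shows "AE \<omega> in P. \<bar>Y \<omega>\<bar> \<le> (1/2::real)"
proof -
  have "AE t in uniform_measure lborel {-1/2<..<1/2::real}. \<bar>t\<bar> \<le> 1/2"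
    by (rule AE_uniform_measureI) auto
  then show ?thesis
    unfolding assms(2)[symmetric] by (rule AE_distrD[OF assms(1)])
qed

text \<open>The deterministic form of the theorem: the \<open>y j\<close> are the values of the random variables at one
  outcome.\<close>

lemma NT_A_add_series:
  fixes Dm :: "(real^'d) set" and R \<mu> \<delta> A0min :: real
    and A0 :: "real^'d \<Rightarrow> real^'d^'d" and \<Psi> :: "nat \<Rightarrow> real^'d \<Rightarrow> real^'d^'d" and y :: "nat \<Rightarrow> real"
  defines "U \<equiv> D_R Dm R"
  defines "B \<equiv> \<lambda>x. A0 x + (\<Sum>j. y j *\<^sub>R \<Psi> j x)"
  assumes A0min: "A0min > 0" "AE x in lebesgue_on U. form_ge (A0 x) A0min"
    and \<Psi>_W: "\<And>j. \<Psi> j \<in> W1inf U"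
    and \<Psi>_sym: "\<And>j. AE x in lebesgue_on U. symmetric_matrix (\<Psi> j x)"
    and \<Psi>_summable: "(\<Sum>j. W1inf_norm U (\<Psi> j)) < \<infinity>"
    and \<Psi>_small: "(\<Sum>j. esssup (lebesgue_on U) (\<lambda>x. ennreal (spectral_norm (\<Psi> j x)))) < ennreal (2 * A0min)"
    and y: "\<And>j. \<bar>y j\<bar> \<le> 1 / 2"
    and B_supp: "compactly_in (ess_supp U (\<lambda>x. mat 1 - B x)) (ball 0 R)"
    and nonneg: "0 \<le> \<delta> * \<mu>"
    and A0_NT: "A0 \<in> NT_A Dm R \<mu>"
    and \<Psi>_NT: "(\<Sum>j. esssup (lebesgue_on U) (\<lambda>x. ennreal (spectral_norm (\<Psi> j x - radial_deriv U (\<Psi> j) x))))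
         \<le> ennreal (2 * \<delta> * \<mu>)"
  shows "B \<in> NT_A Dm R ((1 - \<delta>) * \<mu>)"
proof -
  have U: "open U" unfolding U_def by (rule open_D_R)
  have A0_W: "A0 \<in> W1inf_SPD U" using A0_NT by (simp add: NT_A_def U_def)
  then have A0_W': "A0 \<in> W1inf U" by (simp add: W1inf_SPD_def)
  have y1: "\<bar>y j\<bar> \<le> 1" for j using y[of j] by simp
  note series = W1inf_add_series[where F = \<Psi> and y = y, OF U A0_W' \<Psi>_W \<Psi>_summable y1, folded B_def]
  define s where "s j = enn2real (esssup (lebesgue_on U) (\<lambda>x. ennreal (spectral_norm (\<Psi> j x))))" for j
  define t where "t j = enn2real (esssup (lebesgue_on U)
      (\<lambda>x. ennreal (spectral_norm (\<Psi> j x - radial_deriv U (\<Psi> j) x))))" for j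
  have sfin: "(\<Sum>j. esssup (lebesgue_on U) (\<lambda>x. ennreal (spectral_norm (\<Psi> j x)))) < \<infinity>"
    using \<Psi>_small by (rule less_trans) simp
  have tfin: "(\<Sum>j. esssup (lebesgue_on U)
      (\<lambda>x. ennreal (spectral_norm (\<Psi> j x - radial_deriv U (\<Psi> j) x)))) < \<infinity>"
    using \<Psi>_NT by (rule le_less_trans) simp
  have s: "summable s" "suminf s < 2 * A0min"
    using suminf_ennreal_finite(1,2)[OF sfin] \<Psi>_small
    by (auto simp: s_def[abs_def] ennreal_less_iff suminf_nonneg)
  have t: "summable t" "suminf t \<le> 2 * \<delta> * \<mu>"
    using suminf_ennreal_finite(1,2)[OF tfin] \<Psi>_NT nonneg
    by (auto simp: t_def[abs_def] ennreal_le_iff suminf_nonneg)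
  have AE_s: "AE x in lebesgue_on U. \<forall>j. spectral_norm (\<Psi> j x) \<le> s j"
    unfolding AE_all_countable s_def
    using AE_le_enn2real_esssup[OF suminf_ennreal_finite(3)[OF sfin] spectral_norm_nonneg] by blast
  have AE_t: "AE x in lebesgue_on U. \<forall>j. spectral_norm (\<Psi> j x - radial_deriv U (\<Psi> j) x) \<le> t j"
    unfolding AE_all_countable t_def
    using AE_le_enn2real_esssup[OF suminf_ennreal_finite(3)[OF tfin] spectral_norm_nonneg] by blast
  have "AE x in lebesgue_on U. \<forall>j. symmetric_matrix (\<Psi> j x)"
    using \<Psi>_sym by (simp add: AE_all_countable)
  moreover have "AE x in lebesgue_on U. A0 x \<in> SPD" using A0_W by (simp add: W1inf_SPD_def)
  ultimately have "AE x in lebesgue_on U. B x \<in> SPD"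
    using A0min(2) AE_s series(2)
  proof eventually_elim
    case (elim x)
    have "symmetric_matrix (y j *\<^sub>R \<Psi> j x)" for j
      using elim(1) by (simp add: symmetric_matrix_def transpose_def vec_eq_iff)
    then have "symmetric_matrix (\<Sum>j. y j *\<^sub>R \<Psi> j x)"
      using elim(5) by (rule symmetric_matrix_suminf)
    then have "symmetric_matrix (B x)"
      using elim(2) by (simp add: B_def SPD_def symmetric_matrix_def transpose_def vec_eq_iff)
    moreover have "form_ge (B x) (A0min - 1 / 2 * suminf s)"
      unfolding B_def using elim by (intro form_ge_add_suminf s(1) y) auto
    ultimately show ?case by (rule SPD_if_form_ge) (use s(2) in simp)
  qed
  moreover have "AE x in lebesgue_on U. form_ge (B x - radial_deriv U B x) ((1 - \<delta>) * \<mu>)"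
  proof -
    have "AE x in lebesgue_on U. form_ge (A0 x - radial_deriv U A0 x) \<mu>"
      using A0_NT unfolding NT_A_def U_def[symmetric] by simp
    then show ?thesis
      using AE_t series(2,3)
    proof eventually_elim
      case (elim x)
      have sums: "(\<lambda>j. y j *\<^sub>R (\<Psi> j x - radial_deriv U (\<Psi> j) x)) sums
          ((\<Sum>j. y j *\<^sub>R \<Psi> j x) - (radial_deriv U B x - radial_deriv U A0 x))"
        unfolding scaleR_diff_right using summable_sums[OF elim(3)] elim(4) by (rule sums_diff)
      have "form_ge (A0 x - radial_deriv U A0 x + (\<Sum>j. y j *\<^sub>R (\<Psi> j x - radial_deriv U (\<Psi> j) x)))
          (\<mu> - 1 / 2 * suminf t)"
        using elim sums_summable[OF sums] by (intro form_ge_add_suminf t(1) y) auto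
      then have "form_ge (B x - radial_deriv U B x) (\<mu> - 1 / 2 * suminf t)"
        unfolding sums_unique[OF sums, symmetric] by (simp add: B_def add_diff_eq diff_add_eq)
      moreover have "(1 - \<delta>) * \<mu> \<le> \<mu> - 1 / 2 * suminf t"
        using t(2) by (simp add: algebra_simps)
      ultimately show ?case by (rule form_ge_mono[rotated])
    qed
  qed
  ultimately show ?thesis
    using series(1) B_supp unfolding NT_A_def W1inf_SPD_def U_def[symmetric] by simp
qed

section \<open>The random field\<close>

theorem lemma1p15:
  fixes Dm :: "(real^'d) set" and R \<mu> \<delta> A0min :: real
    and P :: "'w measure"
    and A0 :: "real^'d \<Rightarrow> real^'d^'d"
    and Y :: "nat \<Rightarrow> 'w \<Rightarrow> real"
    and \<Psi> :: "nat \<Rightarrow> real^'d \<Rightarrow> real^'d^'d"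
    and A :: "'w \<Rightarrow> real^'d \<Rightarrow> real^'d^'d"
  assumes dim: "CARD('d) \<in> {2, 3}"
    and obstacle: "obstacle Dm"
    and R_pos: "R > 0"
    and prob: "prob_space P" "complete_measure P"
    and A0_W: "A0 \<in> W1inf_SPD (D_R Dm R)"
    and A0_supp: "compactly_in (ess_supp (D_R Dm R) (\<lambda>x. mat 1 - A0 x)) (ball 0 R)"
    and A0min_pos: "A0min > 0"
    and A0min: "AE x in lebesgue_on (D_R Dm R). form_ge (A0 x) A0min"
    and Y_indep: "prob_space.indep_vars P (\<lambda>_. borel) Y UNIV"
    and Y_uniform: "\<And>j. distr P borel (Y j) = uniform_measure lborel {-1/2<..<1/2}"
    and \<Psi>_W: "\<And>j. \<Psi> j \<in> W1inf (D_R Dm R)"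
    and \<Psi>_sym: "\<And>j. AE x in lebesgue_on (D_R Dm R). symmetric_matrix (\<Psi> j x)"
    and \<Psi>_supp: "\<And>j. compactly_in (ess_supp (D_R Dm R) (\<Psi> j)) (ball 0 R)"
    and \<Psi>_summable: "(\<Sum>j. W1inf_norm (D_R Dm R) (\<Psi> j)) < \<infinity>"
    and \<Psi>_small:
      "(\<Sum>j. esssup (lebesgue_on (D_R Dm R)) (\<lambda>x. ennreal (spectral_norm (\<Psi> j x))))
         < ennreal (2 * A0min)"
    and A_def: "A = random_field A0 Y \<Psi>"
    and A_supp:
      "AE \<omega> in P. compactly_in (ess_supp (D_R Dm R) (\<lambda>x. mat 1 - A \<omega> x)) (ball 0 R)"
    and \<mu>_pos: "\<mu> > 0"
    and \<delta>: "0 < \<delta>" "\<delta> < 1"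
    and A0_NT: "A0 \<in> NT_A Dm R \<mu>"
    and \<Psi>_NT:
      "(\<Sum>j. esssup (lebesgue_on (D_R Dm R))
               (\<lambda>x. ennreal (spectral_norm (\<Psi> j x - radial_deriv (D_R Dm R) (\<Psi> j) x))))
         \<le> ennreal (2 * \<delta> * \<mu>)"
  shows "AE \<omega> in P. A \<omega> \<in> NT_A Dm R ((1 - \<delta>) * \<mu>)"
proof -
  have "Y j \<in> borel_measurable P" for j
    using Y_indep by (simp add: prob_space.indep_vars_def[OF prob(1)])
  then have "AE \<omega> in P. \<bar>Y j \<omega>\<bar> \<le> 1 / 2" for j
    using Y_uniform by (rule AE_abs_le_half_if_uniform)
  then have "AE \<omega> in P. \<forall>j. \<bar>Y j \<omega>\<bar> \<le> 1 / 2"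
    by (subst AE_all_countable) blast
  then show ?thesis
    using A_supp
  proof eventually_elim
    case (elim \<omega>)
    have A: "A \<omega> = (\<lambda>x. A0 x + (\<Sum>j. Y j \<omega> *\<^sub>R \<Psi> j x))"
      by (simp add: A_def random_field_def fun_eq_iff)
    show ?case
      unfolding A
    proof (rule NT_A_add_series[OF A0min_pos A0min \<Psi>_W \<Psi>_sym \<Psi>_summable \<Psi>_small _ _ _ A0_NT \<Psi>_NT])
      show "\<bar>Y j \<omega>\<bar> \<le> 1 / 2" for j using elim(1) by blast
      show "compactly_in (ess_supp (D_R Dm R) (\<lambda>x. mat 1 - (A0 x + (\<Sum>j. Y j \<omega> *\<^sub>R \<Psi> j x)))) (ball 0 R)"
        using elim(2) unfolding A .
      show "0 \<le> \<delta> * \<mu>" using \<delta> \<mu>_pos by simp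
    qed
  qed
qed

end
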